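(* Let $\mathbf{O}$ be an appropriate class of continuous operators such that the functions $\check{c}$ for all $c\in\mathbb{N}$ and the functions $\mu_{k,c}$ for all $k,c\in\mathbb{N}$ are $\mathbf{O}$-representable. Then every conditionally $\mathbf{O}$-computable real function is locally uniformly $\mathbf{O}$-computable.
   Context: For $m\in\mathbb{N}$, $\mathbb{T}_m$ is the set of all total functions $\mathbb{N}^m\to\mathbb{N}$. For $k\in\mathbb{N}$, a $k$-ary operator is a mapping $\mathbb{T}_1^k\to\mathbb{T}_1$. For $c\in\mathbb{N}$, $\check{c}\in\mathbb{T}_1$ is the constant function with value $c$. An operator $F:\mathbb{T}_1^k\to\mathbb{T}_1$ is continuous if for all $f_1,\ldots,f_k\in\mathbb{T}_1$ and $n\in\mathbb{N}$ there is $u\in\mathbb{N}$ such that $F(g_1,\ldots,g_k)(n)=F(f_1,\ldots,f_k)(n)$ whenever $g_1,\ldots,g_k\in\mathbb{T}_1$ agree with $f_1,\ldots,f_k$ respectively on all $t\le u$. A class $\mathbf{O}$ of operators is appropriate if: (1) for all $k$ and $i\in\{1,\ldots,k\}$ the operator $(f_1,\ldots,f_k)\mapsto f_i$ is in $\mathbf{O}$; (2) the operator $F(f_1,f_2)(n)=f_1(f_2(n))$ is in $\mathbf{O}$; (3) if $F$ is a $k$-ary operator in $\mathbf{O}$ and $G_1,\ldots,G_k$ are $l$-ary operators in $\mathbf{O}$, then $H(g_1,\ldots,g_l)=F(G_1(g_1,\ldots,g_l),\ldots,G_k(g_1,\ldots,g_l))$ is in $\mathbf{O}$; (4) if $F$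 is a $(k+1)$-ary operator in $\mathbf{O}$, then $G(f_1,\ldots,f_k)(n)=F(f_1,\ldots,f_k,\check{n})(n)$ is in $\mathbf{O}$. For $f:\mathbb{N}^k\to\mathbb{N}$, $\mathring{f}(f_1,\ldots,f_k)(n)=f(f_1(n),\ldots,f_k(n))$; $f$ is $\mathbf{O}$-representable if $\mathring{f}\in\mathbf{O}$. For $k,c\in\mathbb{N}$, $\mu_{k,c}:\mathbb{N}^2\to\mathbb{N}$ is $\mu_{k,c}(x,y)=c$ if $x=k$ and $y$ otherwise. A triple $(f,g,h)\in\mathbb{T}_1^3$ names $\xi\in\mathbb{R}$ if $\left|\frac{f(t)-g(t)}{h(t)+1}-\xi\right|<\frac{1}{t+1}$ for all $t$. A real function is any $\theta:D\to\mathbb{R}$ with $D\subseteq\mathbb{R}^N$ for some $N$. Such $\theta$ is uniformly $\mathbf{O}$-computable if there are $3N$-ary $F,G,H\in\mathbf{O}$ such that whenever $(\xi_1,\ldots,\xi_N)\in D$ and $(f_j,g_j,h_j)$ names $\xi_j$ ($j=1,\ldots,N$), the triple $(F(\bar f),G(\bar f),H(\bar f))$, with $\bar f=(f_1,g_1,h_1,\ldots,f_N,g_N,h_N)$, names $\theta(\xi_1,\ldots,\xi_N)$. It is conditionally $\mathbf{O}$-computable if there exist a $3N$-ary $E$ and $(3N+1)$-ary $F,G,H$, all in $\mathbf{O}$, such that whenever $(\xi_1,\ldots,\xi_N)\in D$ and $(f_j,g_j,h_j)$ names $\xi_j$: there is $s$ with $E(\bar f)(s)=0$, and for every such $s$ the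 triple $(F(\bar f,\check s),G(\bar f,\check s),H(\bar f,\check s))$ names $\theta(\xi_1,\ldots,\xi_N)$. It is locally uniformly $\mathbf{O}$-computable if every point of $D$ has a neighbourhood $U$ such that the restriction of $\theta$ to $D\cap U$ is uniformly $\mathbf{O}$-computable. *)

theory Defs
  imports "HOL-Analysis.Analysis" "HOL-Analysis.Abstract_Euclidean_Space" "HOL-Library.FuncSet"
begin

type_synonym operator = "(nat \<Rightarrow> nat) list \<Rightarrow> (nat \<Rightarrow> nat)"

text \<open>The \<open>k\<close>-tuples of total functions are the lists of length \<open>k\<close>, with components numbered
  from 0. A \<open>k\<close>-ary operator is an extensional function on these lists, so that equality of
  operators is equality as mappings on the \<open>k\<close>-tuples. A class of operators is a
  family \<open>\<O>\<close> in which \<open>\<O> k\<close> is the set of its \<open>k\<close>-ary members; the arity \<open>k\<close> may be 0.\<close>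

definition tuples :: "nat \<Rightarrow> (nat \<Rightarrow> nat) list set" where
  "tuples k = {fs. length fs = k}"

definition operators :: "nat \<Rightarrow> operator set" where
  "operators k = (tuples k \<rightarrow>\<^sub>E UNIV)"

definition const_fun :: "nat \<Rightarrow> nat \<Rightarrow> nat" where
  "const_fun c = (\<lambda>_. c)"

definition continuous_operator :: "nat \<Rightarrow> operator \<Rightarrow> bool" where
  "continuous_operator k F \<longleftrightarrow>
     (\<forall>fs \<in> tuples k. \<forall>n. \<exists>u. \<forall>gs \<in> tuples k.
        (\<forall>i<k. \<forall>t\<le>u. (gs ! i) t = (fs ! i) t) \<longrightarrow> F gs n = F fs n)"

definition operator_class :: "(nat \<Rightarrow> operator set) \<Rightarrow> bool" where
  "operator_class \<O> \<longleftrightarrow> (\<forall>k. \<O> k \<subseteq> operators k)"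

definition appropriate :: "(nat \<Rightarrow> operator set) \<Rightarrow> bool" where
  "appropriate \<O> \<longleftrightarrow>
     operator_class \<O> \<and>
     (\<forall>k. \<forall>i<k. (\<lambda>fs \<in> tuples k. fs ! i) \<in> \<O> k) \<and>
     (\<lambda>fs \<in> tuples 2. \<lambda>n. (fs ! 0) ((fs ! 1) n)) \<in> \<O> 2 \<and>
     (\<forall>k l. \<forall>F \<in> \<O> k. \<forall>Gs. length Gs = k \<longrightarrow> set Gs \<subseteq> \<O> l \<longrightarrow>
        (\<lambda>gs \<in> tuples l. F (map (\<lambda>G. G gs) Gs)) \<in> \<O> l) \<and>
     (\<forall>k. \<forall>F \<in> \<O> (k + 1).
        (\<lambda>fs \<in> tuples k. \<lambda>n. F (fs @ [const_fun n]) n) \<in> \<O> k)"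

text \<open>A function \<open>\<nat>\<^sup>k \<rightarrow> \<nat>\<close> is given by its values on lists of length \<open>k\<close>; its values on
  other lists do not affect \<open>pointwise_operator\<close>.\<close>

definition pointwise_operator :: "nat \<Rightarrow> (nat list \<Rightarrow> nat) \<Rightarrow> operator" where
  "pointwise_operator k f = (\<lambda>fs \<in> tuples k. \<lambda>n. f (map (\<lambda>g. g n) fs))"

definition representable :: "(nat \<Rightarrow> operator set) \<Rightarrow> nat \<Rightarrow> (nat list \<Rightarrow> nat) \<Rightarrow> bool" where
  "representable \<O> k f \<longleftrightarrow> pointwise_operator k f \<in> \<O> k"

definition mu :: "nat \<Rightarrow> nat \<Rightarrow> nat \<Rightarrow> nat \<Rightarrow> nat" where
  "mu k c x y = (if x = k then c else y)"

definition names :: "(nat \<Rightarrow> nat) \<Rightarrow> (nat \<Rightarrow> nat) \<Rightarrow> (nat \<Rightarrow> nat) \<Rightarrow> real \<Rightarrow> bool" where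
  "names f g h \<xi> \<longleftrightarrow>
     (\<forall>t. \<bar>(real (f t) - real (g t)) / (real (h t) + 1) - \<xi>\<bar> < 1 / (real t + 1))"

text \<open>The list \<open>fs\<close> is \<open>[f\<^sub>1, g\<^sub>1, h\<^sub>1, \<dots>, f\<^sub>N, g\<^sub>N, h\<^sub>N]\<close>. Points of
  \<open>\<real>\<^sup>N\<close> are the points of the library's \<open>Euclidean_space N\<close>, i.e. sequences vanishing from
  index \<open>N\<close> on, so the coordinates are also numbered from 0.\<close>

definition names_point :: "nat \<Rightarrow> (nat \<Rightarrow> nat) list \<Rightarrow> (nat \<Rightarrow> real) \<Rightarrow> bool" where
  "names_point N fs \<xi> \<longleftrightarrow>
     fs \<in> tuples (3 * N) \<and>
     (\<forall>j<N. names (fs ! (3 * j)) (fs ! (3 * j + 1)) (fs ! (3 * j + 2)) (\<xi> j))"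

text \<open>In the following notions the real function is \<open>\<theta>\<close> with domain \<open>D\<close>; the values of \<open>\<theta>\<close>
  outside \<open>D\<close> are never used, so restricting the function amounts to shrinking \<open>D\<close>.\<close>

definition uniformly_computable ::
  "(nat \<Rightarrow> operator set) \<Rightarrow> nat \<Rightarrow> (nat \<Rightarrow> real) set \<Rightarrow> ((nat \<Rightarrow> real) \<Rightarrow> real) \<Rightarrow> bool" where
  "uniformly_computable \<O> N D \<theta> \<longleftrightarrow>
     (\<exists>F \<in> \<O> (3 * N). \<exists>G \<in> \<O> (3 * N). \<exists>H \<in> \<O> (3 * N).
        \<forall>\<xi> \<in> D. \<forall>fs. names_point N fs \<xi> \<longrightarrow> names (F fs) (G fs) (H fs) (\<theta> \<xi>))"

definition conditionally_computable ::
  "(nat \<Rightarrow> operator set) \<Rightarrow> nat \<Rightarrow> (nat \<Rightarrow> real) set \<Rightarrow> ((nat \<Rightarrow> real) \<Rightarrow> real) \<Rightarrow> bool" where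
  "conditionally_computable \<O> N D \<theta> \<longleftrightarrow>
     (\<exists>E \<in> \<O> (3 * N).
      \<exists>F \<in> \<O> (3 * N + 1). \<exists>G \<in> \<O> (3 * N + 1). \<exists>H \<in> \<O> (3 * N + 1).
        \<forall>\<xi> \<in> D. \<forall>fs. names_point N fs \<xi> \<longrightarrow>
          (\<exists>s. E fs s = 0) \<and>
          (\<forall>s. E fs s = 0 \<longrightarrow>
             names (F (fs @ [const_fun s])) (G (fs @ [const_fun s])) (H (fs @ [const_fun s]))
               (\<theta> \<xi>)))"

definition neighbourhood :: "'a topology \<Rightarrow> 'a \<Rightarrow> 'a set \<Rightarrow> bool" where
  "neighbourhood X x U \<longleftrightarrow> U \<subseteq> topspace X \<and> (\<exists>V. openin X V \<and> x \<in> V \<and> V \<subseteq> U)"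

definition locally_uniformly_computable ::
  "(nat \<Rightarrow> operator set) \<Rightarrow> nat \<Rightarrow> (nat \<Rightarrow> real) set \<Rightarrow> ((nat \<Rightarrow> real) \<Rightarrow> real) \<Rightarrow> bool" where
  "locally_uniformly_computable \<O> N D \<theta> \<longleftrightarrow>
     (\<forall>\<xi> \<in> D. \<exists>U. neighbourhood (Euclidean_space N) \<xi> U \<and> uniformly_computable \<O> N (D \<inter> U) \<theta>)"

end

theory Submission
  imports Defs
begin

text \<open>Fix a name \<open>fs\<close> of the given point and some \<open>s\<close> with \<open>E fs s = 0\<close>. By continuity only the
  values of \<open>fs\<close> at arguments below some \<open>u\<close> matter for this. Since the inequalities in a name are
  strict, these finitely many values are admissible initial values for a name of every point close
  enough to the given one. So, near the given point, overwriting the initial values of an arbitrary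
  name by those of \<open>fs\<close> yields another name, for which the same \<open>s\<close> is a zero of \<open>E\<close>. The
  overwriting is done by operators of the class thanks to the functions \<open>mu k c\<close>, and \<open>s\<close> is a
  fixed constant.\<close>

definition patch :: "nat \<Rightarrow> (nat \<Rightarrow> nat) \<Rightarrow> (nat \<Rightarrow> nat) \<Rightarrow> nat \<Rightarrow> nat" where
  "patch u f g = (\<lambda>n. if n < u then f n else g n)"

lemma patch_0 [simp]: "patch 0 f g = g"
  by (simp add: patch_def)

text \<open>Overwriting one more value is a single application of \<open>mu\<close> to the identity
  and the previous patch, which is what makes an induction on \<open>u\<close> possible.\<close>

lemma patch_Suc: "patch (Suc u) f g n = mu u (f u) n (patch u f g n)"
  by (auto simp: patch_def mu_def)

lemma appropriate_proj:
  "appropriate \<O> \<Longrightarrow> i < k \<Longrightarrow> (\<lambda>fs \<in> tuples k. fs ! i) \<in> \<O> k"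
  by (simp add: appropriate_def)

lemma appropriate_compose:
  assumes "appropriate \<O>" "F \<in> \<O> (length Gs)" "set Gs \<subseteq> \<O> l"
  shows "(\<lambda>gs \<in> tuples l. F (map (\<lambda>G. G gs) Gs)) \<in> \<O> l"
  using assms unfolding appropriate_def by blast

lemma appropriate_diagonal:
  assumes "appropriate \<O>" "F \<in> \<O> (Suc k)"
  shows "(\<lambda>fs \<in> tuples k. \<lambda>n. F (fs @ [const_fun n]) n) \<in> \<O> k"
  using assms unfolding appropriate_def by simp

lemma appropriate_representable:
  assumes "appropriate \<O>" "representable \<O> (length Gs) \<phi>" "set Gs \<subseteq> \<O> l"
  shows "(\<lambda>gs \<in> tuples l. \<lambda>n. \<phi> (map (\<lambda>G. G gs n) Gs)) \<in> \<O> l"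
proof -
  have "(\<lambda>gs \<in> tuples l. pointwise_operator (length Gs) \<phi> (map (\<lambda>G. G gs) Gs)) \<in> \<O> l"
    using assms by (intro appropriate_compose) (auto simp: representable_def)
  then show ?thesis
    by (simp add: pointwise_operator_def tuples_def comp_def cong: restrict_cong)
qed

text \<open>The diagonal clause is applied to the last projection: at argument \<open>n\<close> the
  appended input is \<open>const_fun n\<close>, which returns \<open>n\<close>.\<close>

lemma appropriate_identity:
  assumes "appropriate \<O>"
  shows "(\<lambda>gs \<in> tuples l. \<lambda>n. n) \<in> \<O> l"
proof -
  have "(\<lambda>fs \<in> tuples l. \<lambda>n. (\<lambda>fs \<in> tuples (Suc l). fs ! l) (fs @ [const_fun n]) n) \<in> \<O> l"
    by (intro appropriate_diagonal appropriate_proj assms) simp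
  moreover have "(\<lambda>fs \<in> tuples l. \<lambda>n. (\<lambda>fs \<in> tuples (Suc l). fs ! l) (fs @ [const_fun n]) n)
      = (\<lambda>gs \<in> tuples l. \<lambda>n. n)"
    by (rule restrict_ext) (auto simp: tuples_def const_fun_def nth_append)
  ultimately show ?thesis
    by simp
qed

text \<open>The unary constant function needs an \<open>l\<close>-ary operator to be composed with;
  the identity serves, also for \<open>l = 0\<close>, where there are no projections.\<close>

lemma appropriate_const_fun:
  assumes "appropriate \<O>" "representable \<O> 1 (\<lambda>xs. const_fun c (xs ! 0))"
  shows "(\<lambda>gs \<in> tuples l. const_fun c) \<in> \<O> l"
  using appropriate_representable[of \<O> "[\<lambda>gs \<in> tuples l. \<lambda>n. n]" "\<lambda>xs. const_fun c (xs ! 0)" l]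
    assms appropriate_identity[OF assms(1)]
  by (simp add: const_fun_def)

text \<open>Only the finitely many values of \<open>f\<close> below \<open>u\<close> enter, each
  hard-coded in one \<open>mu\<close>, so \<open>f\<close> may be arbitrary.\<close>

lemma appropriate_patch:
  assumes "appropriate \<O>" "\<And>k c. representable \<O> 2 (\<lambda>xs. mu k c (xs ! 0) (xs ! 1))"
    and "G \<in> \<O> l"
  shows "(\<lambda>gs \<in> tuples l. patch u f (G gs)) \<in> \<O> l"
proof (induction u)
  case 0
  have "G \<in> operators l"
    using assms(1,3) unfolding appropriate_def operator_class_def by blast
  then have "(\<lambda>gs \<in> tuples l. G gs) = G"
    by (simp add: operators_def extensional_restrict PiE_def)
  then show ?case
    using assms(3) by simp
next
  case (Suc u)
  let ?Gs = "[\<lambda>gs \<in> tuples l. \<lambda>n. n, \<lambda>gs \<in> tuples l. patch u f (G gs)]"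
  have "(\<lambda>gs \<in> tuples l. \<lambda>n. (\<lambda>xs. mu u (f u) (xs ! 0) (xs ! 1)) (map (\<lambda>G. G gs n) ?Gs)) \<in> \<O> l"
    using assms(2)[of u "f u"] Suc.IH appropriate_identity[OF assms(1), of l]
    by (intro appropriate_representable[OF assms(1)]) (simp_all add: numeral_2_eq_2 del: restrict_apply)
  moreover have "(\<lambda>gs \<in> tuples l. \<lambda>n. (\<lambda>xs. mu u (f u) (xs ! 0) (xs ! 1)) (map (\<lambda>G. G gs n) ?Gs))
      = (\<lambda>gs \<in> tuples l. patch (Suc u) f (G gs))"
    by (rule restrict_ext) (auto simp: patch_Suc)
  ultimately show ?case
    by (simp only:)
qed

lemma names_exists: "\<exists>f g h. names f g h \<xi>"
proof -
  \<comment> \<open>With denominator \<open>t + 1\<close> the rounding error of the floor, less than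
    1, becomes less than \<open>1 / (t + 1)\<close>. The numerator may be negative, so its positive
    and negative parts become the first two functions of the name.\<close>
  define a where "a t = \<lfloor>(real t + 1) * \<xi>\<rfloor>" for t :: nat
  have "\<bar>(real (nat (a t)) - real (nat (- a t))) / (real t + 1) - \<xi>\<bar> < 1 / (real t + 1)" for t
  proof -
    have "real (nat (a t)) - real (nat (- a t)) = real_of_int (a t)"
      by (cases "a t \<ge> 0") auto
    moreover have "\<bar>real_of_int (a t) - (real t + 1) * \<xi>\<bar> < 1"
      unfolding a_def by linarith
    moreover have "real_of_int (a t) / (real t + 1) - \<xi>
        = (real_of_int (a t) - (real t + 1) * \<xi>) / (real t + 1)"
      by (simp add: field_simps)
    ultimately show ?thesis
      by (simp add: abs_divide divide_strict_right_mono)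
  qed
  then show ?thesis
    unfolding names_def by (intro exI[of _ "\<lambda>t. nat (a t)"] exI[of _ "\<lambda>t. nat (- a t)"]
        exI[of _ "\<lambda>t. t"]) auto
qed

lemma names_point_exists: "\<exists>fs. names_point N fs \<xi>"
proof -
  obtain f g h where fgh: "\<And>j. names (f j) (g j) (h j) (\<xi> j)"
    proof -
    have "\<forall>j. \<exists>f g h. names f g h (\<xi> j)"
      using names_exists by blast
    then show thesis
      unfolding choice_iff using that by blast
  qed
  define fs where "fs = map (\<lambda>i. if i mod 3 = 0 then f (i div 3)
      else if i mod 3 = 1 then g (i div 3) else h (i div 3)) [0..<3 * N]"
  have "(3 * j + 1) div 3 = j" "(3 * j + 2) div 3 = j" "(3 * j + 1) mod 3 = 1" "(3 * j + 2) mod 3 = 2"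
    for j :: nat
    by presburger+
  then have "fs ! (3 * j) = f j" "fs ! (3 * j + 1) = g j" "fs ! (3 * j + 2) = h j" if "j < N" for j
    using that by (simp_all add: fs_def del: add_2_eq_Suc' One_nat_def)
  then have "names_point N fs \<xi>"
    using fgh by (auto simp: names_point_def tuples_def fs_def)
  then show ?thesis ..
qed

text \<open>The points for which the values of \<open>fs\<close> at arguments below \<open>u\<close>
  can begin a name: here \<open>fs\<close> is fixed and the point varies.\<close>

definition compatible_below :: "nat \<Rightarrow> nat \<Rightarrow> (nat \<Rightarrow> nat) list \<Rightarrow> (nat \<Rightarrow> real) set" where
  "compatible_below N u fs = {\<eta> \<in> topspace (Euclidean_space N). \<forall>j<N. \<forall>t<u.
     \<bar>(real ((fs ! (3 * j)) t) - real ((fs ! (3 * j + 1)) t)) / (real ((fs ! (3 * j + 2)) t) + 1)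
       - \<eta> j\<bar> < 1 / (real t + 1)}"

lemma openin_compatible_below: "openin (Euclidean_space N) (compatible_below N u fs)"
proof -
  define X where "X = Euclidean_space N"
  define a where "a j t = (real ((fs ! (3 * j)) t) - real ((fs ! (3 * j + 1)) t))
      / (real ((fs ! (3 * j + 2)) t) + 1)" for j t
  define V where "V p = {\<eta> \<in> topspace X. \<eta> (fst p) \<in> ball (a (fst p) (snd p)) (1 / (real (snd p) + 1))}"
    for p :: "nat \<times> nat"
  have "continuous_map X euclideanreal (\<lambda>\<eta>. \<eta> j)" for j
    unfolding X_def Euclidean_space_def
    by (intro continuous_map_from_subtopology continuous_map_product_projection) auto
  then have "openin X (V p)" for p
    unfolding V_def by (rule openin_continuous_map_preimage) auto
  \<comment> \<open>A finite intersection of preimages of open balls under coordinate projections;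
    the factor \<open>topspace X\<close> covers an empty index set.\<close>
  then have "openin X ((\<Inter>p\<in>{..<N} \<times> {..<u}. V p) \<inter> topspace X)"
    by (intro openin_INT) auto
  also have "(\<Inter>p\<in>{..<N} \<times> {..<u}. V p) \<inter> topspace X = compatible_below N u fs"
    by (auto simp: compatible_below_def V_def X_def a_def dist_real_def)
  finally show ?thesis
    by (simp add: X_def)
qed

lemma names_point_imp_compatible_below:
  "names_point N fs \<xi> \<Longrightarrow> \<xi> \<in> topspace (Euclidean_space N) \<Longrightarrow> \<xi> \<in> compatible_below N u fs"
  by (auto simp: names_point_def names_def compatible_below_def)

text \<open>The naming condition at \<open>t\<close> involves only the values at \<open>t\<close>,
  so it splits: below \<open>u\<close> it is compatibility with \<open>fs\<close>, from
  \<open>u\<close> on it is inherited from \<open>gs\<close>.\<close>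

lemma names_point_patch:
  assumes "names_point N gs \<eta>" "\<eta> \<in> compatible_below N u fs"
  shows "names_point N (map (\<lambda>i. patch u (fs ! i) (gs ! i)) [0..<3 * N]) \<eta>"
  using assms
  by (auto simp: names_point_def names_def compatible_below_def tuples_def patch_def)

theorem theorem2:
  fixes \<O> :: "nat \<Rightarrow> operator set"
    and N :: nat
    and D :: "(nat \<Rightarrow> real) set"
    and \<theta> :: "(nat \<Rightarrow> real) \<Rightarrow> real"
  assumes "appropriate \<O>"
    and "\<And>k F. F \<in> \<O> k \<Longrightarrow> continuous_operator k F"
    and "\<And>c. representable \<O> 1 (\<lambda>xs. const_fun c (xs ! 0))"
    and "\<And>k c. representable \<O> 2 (\<lambda>xs. mu k c (xs ! 0) (xs ! 1))"
    and "D \<subseteq> topspace (Euclidean_space N)"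
    and "conditionally_computable \<O> N D \<theta>"
  shows "locally_uniformly_computable \<O> N D \<theta>"
  unfolding locally_uniformly_computable_def
proof
  fix \<xi> assume \<xi>: "\<xi> \<in> D"
  obtain E F G H where E: "E \<in> \<O> (3 * N)"
    and FGH: "F \<in> \<O> (3 * N + 1)" "G \<in> \<O> (3 * N + 1)" "H \<in> \<O> (3 * N + 1)"
    and zero: "\<And>\<xi> fs. \<xi> \<in> D \<Longrightarrow> names_point N fs \<xi> \<Longrightarrow> \<exists>s. E fs s = 0"
    and name: "\<And>\<xi> fs s. \<xi> \<in> D \<Longrightarrow> names_point N fs \<xi> \<Longrightarrow> E fs s = 0 \<Longrightarrow>
      names (F (fs @ [const_fun s])) (G (fs @ [const_fun s])) (H (fs @ [const_fun s])) (\<theta> \<xi>)"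
    using assms(6) unfolding conditionally_computable_def by blast
  obtain fs where fs: "names_point N fs \<xi>"
    using names_point_exists by blast
  then obtain s where s: "E fs s = 0"
    using zero \<xi> by blast
  have "fs \<in> tuples (3 * N)"
    using fs by (simp add: names_point_def)
  then obtain u where u: "\<And>gs. gs \<in> tuples (3 * N) \<Longrightarrow>
      (\<And>i t. i < 3 * N \<Longrightarrow> t \<le> u \<Longrightarrow> (gs ! i) t = (fs ! i) t) \<Longrightarrow> E gs s = E fs s"
    using assms(2)[OF E] unfolding continuous_operator_def by meson
  \<comment> \<open>\<open>Suc u\<close>, because continuity demands agreement up to and including
    \<open>u\<close>, whereas the bounds in \<open>compatible_below\<close> and \<open>patch\<close>
    are strict.\<close>
  define U where "U = compatible_below N (Suc u) fs"
  define P where "P gs = map (\<lambda>i. patch (Suc u) (fs ! i) (gs ! i)) [0..<3 * N]" for gs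
  \<comment> \<open>The operators to substitute into \<open>F\<close>, \<open>G\<close> and
    \<open>H\<close>: patched projections, then the constant \<open>s\<close> in the last place, so
    that no search for a zero remains.\<close>
  define Gs :: "operator list" where "Gs = map (\<lambda>i. \<lambda>gs \<in> tuples (3 * N).
      patch (Suc u) (fs ! i) ((\<lambda>gs \<in> tuples (3 * N). gs ! i) gs)) [0..<3 * N]
      @ [\<lambda>gs \<in> tuples (3 * N). const_fun s]"
  have Gs: "set Gs \<subseteq> \<O> (3 * N)" "length Gs = 3 * N + 1"
    using assms(1,3,4)
    by (auto simp: Gs_def simp del: restrict_apply
        intro!: appropriate_patch appropriate_proj appropriate_const_fun)
  have Gs_apply: "map (\<lambda>G. G gs) Gs = P gs @ [const_fun s]" if "gs \<in> tuples (3 * N)" for gs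
    using that by (simp add: Gs_def P_def)
  have patched: "(\<lambda>gs \<in> tuples (3 * N). K (P gs @ [const_fun s])) \<in> \<O> (3 * N)"
    if "K \<in> \<O> (3 * N + 1)" for K
    using appropriate_compose[of \<O> K Gs "3 * N"] that Gs assms(1)
    by (simp add: Gs_apply cong: restrict_cong)
  have "names (F (P gs @ [const_fun s])) (G (P gs @ [const_fun s])) (H (P gs @ [const_fun s])) (\<theta> \<eta>)"
    if "\<eta> \<in> D \<inter> U" "names_point N gs \<eta>" for \<eta> gs
  proof (rule name)
    show "\<eta> \<in> D"
      using that by simp
    show "names_point N (P gs) \<eta>"
      using that names_point_patch unfolding P_def U_def by blast
    \<comment> \<open>Whatever \<open>gs\<close> is, \<open>P gs\<close> agrees with
      \<open>fs\<close> through \<open>u\<close>.\<close>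
    have "E (P gs) s = E fs s"
      by (rule u) (auto simp: P_def tuples_def patch_def)
    then show "E (P gs) s = 0"
      using s by simp
  qed
  then have "uniformly_computable \<O> N (D \<inter> U) \<theta>"
    unfolding uniformly_computable_def
    by (intro bexI[OF _ patched[OF FGH(1)]] bexI[OF _ patched[OF FGH(2)]]
        bexI[OF _ patched[OF FGH(3)]]) (auto simp: names_point_def)
  moreover have "neighbourhood (Euclidean_space N) \<xi> U"
    unfolding neighbourhood_def U_def
  proof (intro conjI exI)
    show "\<xi> \<in> compatible_below N (Suc u) fs"
      using names_point_imp_compatible_below fs \<xi> assms(5) by blast
  qed (simp_all add: openin_compatible_below openin_subset)
  ultimately show "\<exists>U. neighbourhood (Euclidean_space N) \<xi> U \<and> uniformly_computable \<O> N (D \<inter> U) \<theta>"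
    by blast
qed

end
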